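(* Let $N,M\in\mathbb{N}$, $y\in\mathbb{C}^N$, $\mu>0$, let $A\in\mathbb{C}^{N\times M}$ have full row rank, and let $D\in\mathbb{C}^{M\times M}$ be non-singular. Let $x_{\ell_1}\in\mathbb{C}^M$ be a solution of the generalized LASSO problem $$\min_{x\in\mathbb{C}^M}\ \|y-Ax\|_2^2+\mu\|Dx\|_1 ,$$ and let $u\in\mathbb{C}^M$ be the corresponding dual vector (a solution of the dual problem defined in the context). Then $$u=2D^{-H}A^H\left(y-Ax_{\ell_1}\right).$$
   Context: $X^H$ denotes the Hermitian (conjugate) transpose and $D^{-H}=(D^H)^{-1}$. For $v\in\mathbb{C}^M$, $\|v\|_1=\sum_m|v_m|$ with $|\cdot|$ the complex modulus. Dual problem and dual vector: the generalized LASSO problem is rewritten as $\min_{x,z\in\mathbb{C}^M}\|y-Ax\|_2^2+\mu\|z\|_1$ subject to $z=Dx$. A complex vector $u\in\mathbb{C}^M$ is associated with the equality constraint, giving the Lagrangian $\mathcal{L}(x,z,u)=\|y-Ax\|_2^2+\mu\|z\|_1+\mathrm{Re}[u^H(Dx-z)]$. The dual problem is to maximize $g(u)=\inf_{x,z\in\mathbb{C}^M}\mathcal{L}(x,z,u)$ over $u\in\mathbb{C}^M$; a dual vector is a maximizer of $g$. *)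

theory Defs
  imports "HOL-Analysis.Analysis"
begin

definition hermitian_transpose :: "complex^'m^'n \<Rightarrow> complex^'n^'m" where
  "hermitian_transpose X = map_matrix cnj (transpose X)"

definition l1_norm :: "complex^'m \<Rightarrow> real" where
  "l1_norm v = (\<Sum>m\<in>UNIV. cmod (v $ m))"

text \<open>The scalar \<open>u\<^sup>H v\<close>, conjugate-linear in the first argument.\<close>

definition hermitian_dot :: "complex^'m \<Rightarrow> complex^'m \<Rightarrow> complex" where
  "hermitian_dot u v = (\<Sum>m\<in>UNIV. cnj (u $ m) * v $ m)"

text \<open>The library norm on \<^typ>\<open>complex^'n\<close> is the Euclidean norm of the componentwise moduli.\<close>

definition lasso_objective ::
  "complex^'n \<Rightarrow> complex^'m^'n \<Rightarrow> complex^'m^'m \<Rightarrow> real \<Rightarrow> complex^'m \<Rightarrow> real" where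
  "lasso_objective y A D \<mu> x = (norm (y - A *v x))\<^sup>2 + \<mu> * l1_norm (D *v x)"

definition lasso_lagrangian ::
  "complex^'n \<Rightarrow> complex^'m^'n \<Rightarrow> complex^'m^'m \<Rightarrow> real
    \<Rightarrow> complex^'m \<Rightarrow> complex^'m \<Rightarrow> complex^'m \<Rightarrow> real" where
  "lasso_lagrangian y A D \<mu> x z u =
     (norm (y - A *v x))\<^sup>2 + \<mu> * l1_norm z + Re (hermitian_dot u (D *v x - z))"

text \<open>The infimum may be \<open>-\<infinity>\<close>, so the dual function takes extended real values.\<close>

definition lasso_dual ::
  "complex^'n \<Rightarrow> complex^'m^'n \<Rightarrow> complex^'m^'m \<Rightarrow> real \<Rightarrow> complex^'m \<Rightarrow> ereal" where
  "lasso_dual y A D \<mu> u = (INF (x, z)\<in>UNIV. ereal (lasso_lagrangian y A D \<mu> x z u))"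

definition is_lasso_solution ::
  "complex^'n \<Rightarrow> complex^'m^'n \<Rightarrow> complex^'m^'m \<Rightarrow> real \<Rightarrow> complex^'m \<Rightarrow> bool" where
  "is_lasso_solution y A D \<mu> x \<longleftrightarrow> is_arg_min (lasso_objective y A D \<mu>) (\<lambda>_. True) x"

definition is_dual_vector ::
  "complex^'n \<Rightarrow> complex^'m^'n \<Rightarrow> complex^'m^'m \<Rightarrow> real \<Rightarrow> complex^'m \<Rightarrow> bool" where
  "is_dual_vector y A D \<mu> u \<longleftrightarrow> is_arg_max (lasso_dual y A D \<mu>) (\<lambda>_. True) u"

end

theory Submission
  imports Defs
begin

text \<open>
  Put \<open>r = y - A x\<close> for the LASSO solution \<open>x\<close>, and let \<open>u\<^sub>0\<close> be the vector with
  \<open>D\<^sup>H u\<^sub>0 = 2 A\<^sup>H r\<close>, which is the right-hand side of the theorem.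

  First, \<open>u\<^sub>0\<close> certifies strong duality. Moving from \<open>x\<close> a short way in a direction \<open>h\<close> does not
  decrease the objective, and since the \<open>\<ell>\<^sub>1\<close> norm is convex this yields the variational
  inequality \<open>2 Re (r\<^sup>H A h) \<le> \<mu> (\<parallel>D (x + h)\<parallel>\<^sub>1 - \<parallel>D x\<parallel>\<^sub>1)\<close> (\<open>lasso_solution_variational\<close>).
  As \<open>D\<close> is onto, it says that \<open>u\<^sub>0\<close> is a subgradient of \<open>\<mu> \<parallel>\<cdot>\<parallel>\<^sub>1\<close> at \<open>D x\<close>. Together with the
  tangent inequality of the quadratic term it shows that the Lagrangian at \<open>u\<^sub>0\<close> never drops
  below the optimal primal value (\<open>lagrangian_lower_bound_of_certificate\<close>).

  Hence a maximizer \<open>u\<close> of the dual function also has dual value at least the optimal primal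
  value. That value is attained by the Lagrangian at \<open>(x, D x, u)\<close>, so \<open>x\<close> minimizes the smooth
  function \<open>x' \<mapsto> \<L>(x', D x, u)\<close>. Stationarity reads \<open>D\<^sup>H u = 2 A\<^sup>H r\<close>
  (\<open>stationary_of_lagrangian_lower_bound\<close>), and \<open>D\<^sup>H\<close> is invertible, so \<open>u = u\<^sub>0\<close>.

  The argument is carried out in the real inner product space underlying \<open>\<complex>\<^sup>M\<close>, whose inner
  product is the real part of the Hermitian one.
\<close>

lemma Re_hermitian_dot: "Re (hermitian_dot u v) = u \<bullet> v"
  by (simp add: hermitian_dot_def inner_vec_def inner_complex_def)

lemma inner_hermitian_transpose:
  fixes X :: "complex^'m^'n"
  shows "v \<bullet> (X *v w) = (hermitian_transpose X *v v) \<bullet> w"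
proof -
  have "hermitian_dot v (X *v w) = hermitian_dot (hermitian_transpose X *v v) w"
    unfolding hermitian_dot_def hermitian_transpose_def matrix_vector_mult_def transpose_def
      map_matrix_def
    by (simp add: sum_distrib_left sum_distrib_right mult_ac) (rule sum.swap)
  then show ?thesis by (metis Re_hermitian_dot)
qed

lemma hermitian_transpose_mult:
  fixes X :: "complex^'m^'n" and Y :: "complex^'k^'m"
  shows "hermitian_transpose (X ** Y) = hermitian_transpose Y ** hermitian_transpose X"
  by (simp add: hermitian_transpose_def map_matrix_def transpose_def matrix_matrix_mult_def
      vec_eq_iff mult.commute)

lemma hermitian_transpose_mat_1: "hermitian_transpose (mat 1) = mat 1"
  by (simp add: hermitian_transpose_def map_matrix_def transpose_def mat_def vec_eq_iff)

lemma invertible_hermitian_transpose: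
  "invertible X \<Longrightarrow> invertible (hermitian_transpose X)"
  unfolding invertible_def
  by (metis hermitian_transpose_mult hermitian_transpose_mat_1)

lemma invertible_matrix_inv_right: "invertible X \<Longrightarrow> X ** matrix_inv X = mat 1"
  and invertible_matrix_inv_left: "invertible X \<Longrightarrow> matrix_inv X ** X = mat 1"
  unfolding invertible_def matrix_inv_def by (metis (mono_tags, lifting) someI_ex)+

lemma complex_matrix_vector_scaleR:
  fixes X :: "complex^'m^'n"
  shows "X *v (t *\<^sub>R v) = t *\<^sub>R (X *v v)"
  by (simp add: matrix_vector_mult_def vec_eq_iff scaleR_sum_right)

text \<open>Convexity of the \<open>\<ell>\<^sub>1\<close> norm along a segment starting at \<open>v\<close>.\<close>

lemma l1_norm_segment_le:
  assumes "0 \<le> t" "t \<le> 1"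
  shows "l1_norm (v + t *\<^sub>R w) \<le> l1_norm v + t * (l1_norm (v + w) - l1_norm v)"
proof -
  have "cmod ((v + t *\<^sub>R w) $ i) \<le> (1 - t) * cmod (v $ i) + t * cmod ((v + w) $ i)" for i
  proof -
    have "(v + t *\<^sub>R w) $ i = (1 - t) *\<^sub>R (v $ i) + t *\<^sub>R ((v + w) $ i)"
      by (simp add: algebra_simps)
    also have "cmod \<dots> \<le> cmod ((1 - t) *\<^sub>R (v $ i)) + cmod (t *\<^sub>R ((v + w) $ i))"
      by (rule norm_triangle_ineq)
    finally show ?thesis using assms by simp
  qed
  then have "l1_norm (v + t *\<^sub>R w)
      \<le> (\<Sum>i\<in>UNIV. (1 - t) * cmod (v $ i) + t * cmod ((v + w) $ i))"
    unfolding l1_norm_def by (rule sum_mono)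
  also have "\<dots> = (1 - t) * l1_norm v + t * l1_norm (v + w)"
    by (simp add: l1_norm_def sum.distrib sum_distrib_left)
  finally show ?thesis by (simp add: algebra_simps)
qed

text \<open>First-order optimality in one real variable: near \<open>0\<close> the linear term dominates.\<close>

lemma linear_coeff_nonneg:
  fixes a b :: real
  assumes "\<And>t. 0 < t \<Longrightarrow> t \<le> 1 \<Longrightarrow> 0 \<le> t * b + t\<^sup>2 * a"
  shows "0 \<le> b"
proof (rule tendsto_lowerbound)
  show "((\<lambda>t. b + t * a) \<longlongrightarrow> b) (at_right 0)"
    by (auto intro!: tendsto_eq_intros)
  have "0 \<le> b + t * a" if "0 < t" "t < 1" for t
  proof -
    have "0 \<le> t * (b + t * a)"
      using assms[of t] that by (simp add: algebra_simps power2_eq_square)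
    with that show ?thesis by (simp add: zero_le_mult_iff)
  qed
  then show "\<forall>\<^sub>F t in at_right 0. 0 \<le> b + t * a"
    unfolding eventually_at_right_field by (intro exI[of _ 1]) auto
qed simp

lemma residual_expand:
  fixes A :: "complex^'m^'n"
  shows "(norm (y - A *v (x + h)))\<^sup>2
    = (norm (y - A *v x))\<^sup>2 - 2 * ((y - A *v x) \<bullet> (A *v h)) + (norm (A *v h))\<^sup>2"
proof -
  have "(norm (r - a))\<^sup>2 = (norm r)\<^sup>2 - 2 * (r \<bullet> a) + (norm a)\<^sup>2"
    for r a :: "complex^'n"
    using dot_norm_neg[of r a] by (simp add: field_simps)
  moreover have "y - A *v (x + h) = (y - A *v x) - A *v h"
    by (simp only: matrix_vector_right_distrib diff_diff_eq)
  ultimately show ?thesis by metis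
qed

lemma residual_expand_scaleR:
  fixes A :: "complex^'m^'n"
  shows "(norm (y - A *v (x + t *\<^sub>R h)))\<^sup>2 = (norm (y - A *v x))\<^sup>2
    - t * (2 * ((y - A *v x) \<bullet> (A *v h))) + t\<^sup>2 * (norm (A *v h))\<^sup>2"
  by (simp only: residual_expand complex_matrix_vector_scaleR inner_scaleR_right norm_scaleR
      power_mult_distrib power2_abs mult.left_commute)

text \<open>
  The optimality condition \<open>0 \<in> \<partial>F(x)\<close> of the LASSO objective \<open>F\<close>, stated without
  subdifferentials.
\<close>

lemma lasso_solution_variational:
  assumes "\<mu> > 0" and "is_lasso_solution y A D \<mu> x"
  shows "2 * ((y - A *v x) \<bullet> (A *v h)) \<le> \<mu> * (l1_norm (D *v (x + h)) - l1_norm (D *v x))"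
proof -
  define c where "c = l1_norm (D *v (x + h)) - l1_norm (D *v x)"
  define b where "b = \<mu> * c - 2 * ((y - A *v x) \<bullet> (A *v h))"
  have "0 \<le> t * b + t\<^sup>2 * (norm (A *v h))\<^sup>2" if t: "0 < t" "t \<le> 1" for t
  proof -
    have "lasso_objective y A D \<mu> x \<le> lasso_objective y A D \<mu> (x + t *\<^sub>R h)"
      using assms(2) by (simp add: is_lasso_solution_def is_arg_min_linorder)
    moreover have "l1_norm (D *v (x + t *\<^sub>R h)) \<le> l1_norm (D *v x) + t * c"
      using l1_norm_segment_le[of t "D *v x" "D *v h"] t
      by (simp add: c_def matrix_vector_right_distrib complex_matrix_vector_scaleR)
    then have "\<mu> * l1_norm (D *v (x + t *\<^sub>R h)) \<le> \<mu> * (l1_norm (D *v x) + t * c)"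
      using assms(1) by simp
    moreover have "t * b = \<mu> * (l1_norm (D *v x) + t * c) - \<mu> * l1_norm (D *v x)
        - t * (2 * ((y - A *v x) \<bullet> (A *v h)))"
      by (simp add: b_def right_diff_distrib distrib_left)
    ultimately show ?thesis
      by (simp add: lasso_objective_def residual_expand_scaleR)
  qed
  then have "0 \<le> b" by (rule linear_coeff_nonneg)
  then show ?thesis by (simp add: b_def c_def)
qed

text \<open>
  Strong duality: the stationarity equation \<open>D\<^sup>H u = 2 A\<^sup>H (y - A x)\<close> turns the tangent
  inequalities of the two terms of the Lagrangian into bounds whose linear parts cancel
  against the coupling term \<open>Re (u\<^sup>H (D x' - z))\<close>.
\<close>

lemma lagrangian_lower_bound_of_certificate:
  assumes "\<mu> > 0" and "invertible D" and sol: "is_lasso_solution y A D \<mu> x"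
    and u: "hermitian_transpose D *v u = 2 *\<^sub>R (hermitian_transpose A *v (y - A *v x))"
  shows "lasso_objective y A D \<mu> x \<le> lasso_lagrangian y A D \<mu> x' z u"
proof -
  have pair: "u \<bullet> (D *v h) = 2 * ((y - A *v x) \<bullet> (A *v h))" for h
    by (simp add: inner_hermitian_transpose u)
  define h where "h = matrix_inv D *v z - x"
  have z: "D *v (x + h) = z"
    using \<open>invertible D\<close>
    by (simp add: h_def matrix_vector_mul_assoc invertible_matrix_inv_right)
  have "u \<bullet> (D *v h) \<le> \<mu> * (l1_norm z - l1_norm (D *v x))"
    using lasso_solution_variational[OF \<open>\<mu> > 0\<close> sol, of h] by (simp add: pair z)
  moreover have "(norm (y - A *v x))\<^sup>2 - u \<bullet> (D *v (x' - x)) \<le> (norm (y - A *v x'))\<^sup>2"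
    using residual_expand[of y A x "x' - x"] by (simp add: pair)
  moreover have "u \<bullet> (D *v x' - z) = u \<bullet> (D *v (x' - x)) - u \<bullet> (D *v h)"
    by (simp add: z[symmetric] matrix_vector_right_distrib matrix_vector_mult_diff_distrib
        inner_diff_right inner_add_right)
  ultimately show ?thesis
    by (simp add: lasso_objective_def lasso_lagrangian_def Re_hermitian_dot algebra_simps)
qed

text \<open>
  Conversely, such a bound forces stationarity: with \<open>z = D x\<close> fixed it is attained at
  \<open>x' = x\<close>, where the real gradient \<open>D\<^sup>H u - 2 A\<^sup>H (y - A x)\<close> in \<open>x'\<close> must therefore vanish.
\<close>

lemma stationary_of_lagrangian_lower_bound:
  assumes bound: "\<And>x'. lasso_objective y A D \<mu> x \<le> lasso_lagrangian y A D \<mu> x' (D *v x) u"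
  shows "hermitian_transpose D *v u = 2 *\<^sub>R (hermitian_transpose A *v (y - A *v x))"
proof -
  define w where
    "w = hermitian_transpose D *v u - 2 *\<^sub>R (hermitian_transpose A *v (y - A *v x))"
  have nonneg: "0 \<le> t * (w \<bullet> h) + t\<^sup>2 * (norm (A *v h))\<^sup>2" for t h
  proof -
    have "w \<bullet> h = u \<bullet> (D *v h) - 2 * ((y - A *v x) \<bullet> (A *v h))"
      by (simp only: w_def inner_diff_left inner_scaleR_left inner_hermitian_transpose)
    then have "t * (w \<bullet> h) = t * (u \<bullet> (D *v h)) - t * (2 * ((y - A *v x) \<bullet> (A *v h)))"
      by (simp only: right_diff_distrib)
    moreover have "D *v (x + t *\<^sub>R h) - D *v x = t *\<^sub>R (D *v h)"
      by (simp add: matrix_vector_right_distrib complex_matrix_vector_scaleR)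
    ultimately show ?thesis
      using bound[of "x + t *\<^sub>R h"]
      by (simp add: lasso_objective_def lasso_lagrangian_def Re_hermitian_dot
          residual_expand_scaleR)
  qed
  \<comment> \<open>Descending along the gradient, \<open>h = - w\<close>, leaves no room unless it vanishes.\<close>
  have "0 \<le> w \<bullet> (- w)"
    by (rule linear_coeff_nonneg) (rule nonneg)
  then have "w = 0"
    by (metis inner_gt_zero_iff inner_minus_right neg_0_le_iff_le not_le)
  then show ?thesis by (simp add: w_def)
qed

theorem theorem1:
  fixes y :: "complex^'n" and A :: "complex^'m^'n" and D :: "complex^'m^'m"
    and \<mu> :: real and x_l1 u :: "complex^'m"
  assumes "\<mu> > 0"
    and "rank A = CARD('n)"
    and "invertible D"
    and "is_lasso_solution y A D \<mu> x_l1"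
    and "is_dual_vector y A D \<mu> u"
  shows "u = 2 *s (matrix_inv (hermitian_transpose D) *v
                     (hermitian_transpose A *v (y - A *v x_l1)))"
proof -
  let ?DH = "hermitian_transpose D" and ?g = "lasso_dual y A D \<mu>"
  let ?p = "lasso_objective y A D \<mu> x_l1"
  define s where "s = hermitian_transpose A *v (y - A *v x_l1)"
  define u0 where "u0 = matrix_inv ?DH *v (2 *\<^sub>R s)"
  have inv: "invertible ?DH"
    using assms(3) by (rule invertible_hermitian_transpose)
  have "?DH *v u0 = 2 *\<^sub>R s"
    by (simp add: u0_def matrix_vector_mul_assoc invertible_matrix_inv_right[OF inv])
  then have "?p \<le> lasso_lagrangian y A D \<mu> x z u0" for x z
    using lagrangian_lower_bound_of_certificate[OF assms(1,3,4)] by (simp add: s_def)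
  then have "ereal ?p \<le> ?g u0"
    unfolding lasso_dual_def by (auto intro!: INF_greatest)
  also have "?g u0 \<le> ?g u"
    using assms(5) by (simp add: is_dual_vector_def is_arg_max_linorder)
  finally have "ereal ?p \<le> ?g u" .
  moreover have "?g u \<le> ereal (lasso_lagrangian y A D \<mu> x z u)" for x z
    unfolding lasso_dual_def by (rule INF_lower2[of "(x, z)"]) auto
  ultimately have "?p \<le> lasso_lagrangian y A D \<mu> x z u" for x z
    by (meson ereal_less_eq(3) order_trans)
  then have "?DH *v u = 2 *\<^sub>R s"
    unfolding s_def by (intro stationary_of_lagrangian_lower_bound)
  then have "matrix_inv ?DH *v (?DH *v u) = 2 *\<^sub>R (matrix_inv ?DH *v s)"
    by (simp add: complex_matrix_vector_scaleR)
  then have "u = 2 *\<^sub>R (matrix_inv ?DH *v s)"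
    by (simp add: matrix_vector_mul_assoc invertible_matrix_inv_left[OF inv])
  also have "\<dots> = 2 *s (matrix_inv ?DH *v s)"
    by (simp add: vec_eq_iff scaleR_conv_of_real)
  finally show ?thesis by (simp add: s_def)
qed

end
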